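(* Consider the graph $G=K_6\setminus\{\{2,5\},\{3,6\}\}$ on vertex set $[6]$, and six points $\mathbf q=(q_1,\dots,q_6)$ in general position in $\mathbb{R}^2$. Then: (1) $G$ is spanning in $\mathcal{C}_3(\mathbf q)$, hence the rows of $C_3(\mathbf q)$ indexed by $G$ have a unique (up to scalar) linear dependence; this dependence is nonzero at every edge of $G$ other than possibly $\{1,4\}$. (2) Assume $\mathbf q$ is in convex position and let $(\lambda_{ij})$ be this unique dependence. Then $\lambda_{15}\ne0$ and $\lambda_{14}/\lambda_{15}$ is positive, negative, or zero if $\mathbf q$ is positively oriented, negatively oriented, or in Desargues position, respectively.
   Context: General position: no three of the points are collinear. Convex position: $q_1,\dots,q_6$ are the vertices of a convex hexagon, in this cyclic order. For $\mathbf q=(q_1,\dots,q_n)$ with $q_i=(x_i,y_i)\in\mathbb{R}^2$ and $d\ge1$, the cofactor rigidity matrix $C_d(\mathbf q)$ has one row per edge $\{i,j\}\in\binom{[n]}{2}$, $i<j$, and one block of $d$ columns per vertex; the row of $\{i,j\}$ has $\mathbf c_{ij}$ in block $i$, $-\mathbf c_{ij}$ in block $j$ and zeros elsewhere, where $\mathbf c_{ij}=\big((x_i-x_j)^{d-1},(y_i-y_j)(x_i-x_j)^{d-2},\dots,(y_i-y_j)^{d-1}\big)$. $\mathcal C_d(\mathbf q)$ is the (oriented) linear matroid of its rows. A set of edges is spanning if its rows span the row space. For $\mathbf q=(q_1,\dots,q_6)$ in convex position, call upper side of the line $q_2q_5$ the side containing $q_1$ and $q_6$, and lower side the other one. $\mathbf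 q$ is positively (resp. negatively) oriented if the intersection point of the lines $q_1q_4$ and $q_3q_6$ lies in the (open) lower (resp. upper) side of the line $q_2q_5$; $\mathbf q$ is in Desargues position if the lines $q_1q_4$, $q_2q_5$, $q_3q_6$ are concurrent. *)

theory Defs
  imports "HOL-Analysis.Analysis" "HOL-Library.Function_Algebras"
begin

text \<open>
  Point configurations in the plane are functions \<open>q :: nat \<Rightarrow> real \<times> real\<close>, of which only
  the values at \<open>1, \<dots>, n\<close> matter. Edges are two-element sets of vertices.
\<close>

definition complete_graph :: "nat \<Rightarrow> nat set set" where
  "complete_graph n = {e. e \<subseteq> {1..n} \<and> card e = 2}"

definition general_position :: "nat \<Rightarrow> (nat \<Rightarrow> real \<times> real) \<Rightarrow> bool" where
  "general_position n q \<longleftrightarrow>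
     (\<forall>i\<in>{1..n}. \<forall>j\<in>{1..n}. \<forall>k\<in>{1..n}.
        i \<noteq> j \<longrightarrow> i \<noteq> k \<longrightarrow> j \<noteq> k \<longrightarrow> \<not> collinear {q i, q j, q k})"

definition convex_position :: "nat \<Rightarrow> (nat \<Rightarrow> real \<times> real) \<Rightarrow> bool" where
  "convex_position n q \<longleftrightarrow>
     3 \<le> n \<and> inj_on q {1..n} \<and>
     {v. v extreme_point_of (convex hull (q ` {1..n}))} = q ` {1..n} \<and>
     (\<forall>i\<in>{1..n}. closed_segment (q i) (q (if i = n then 1 else i + 1))
                  edge_of (convex hull (q ` {1..n})))"


text \<open>
  The columns of the cofactor rigidity matrix are indexed by pairs \<open>(v, k)\<close>: the column
  number \<open>k < d\<close>, counted from 0, of the block of vertex \<open>v\<close>. A row is a function on such pairs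
  (zero at pairs that are not column indices), and the row of an edge \<open>{i, j}\<close> with
  \<open>i < j\<close> has \<open>i = Min e\<close> and \<open>j = Max e\<close>.
\<close>

definition cofactor_vector :: "nat \<Rightarrow> real \<times> real \<Rightarrow> real \<times> real \<Rightarrow> nat \<Rightarrow> real" where
  "cofactor_vector d a b k =
     (if k < d then (snd a - snd b) ^ k * (fst a - fst b) ^ (d - 1 - k) else 0)"

definition cofactor_matrix :: "nat \<Rightarrow> (nat \<Rightarrow> real \<times> real) \<Rightarrow> nat set \<Rightarrow> nat \<times> nat \<Rightarrow> real" where
  "cofactor_matrix d q e =
     (\<lambda>(v, k). if v = Min e then cofactor_vector d (q (Min e)) (q (Max e)) k
               else if v = Max e then - cofactor_vector d (q (Min e)) (q (Max e)) k
               else 0)"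

definition fun_scale :: "real \<Rightarrow> ('a \<Rightarrow> real) \<Rightarrow> 'a \<Rightarrow> real" where
  "fun_scale c f = (\<lambda>x. c * f x)"

global_interpretation fun_space: vector_space "fun_scale :: real \<Rightarrow> ('a \<Rightarrow> real) \<Rightarrow> 'a \<Rightarrow> real"
  by unfold_locales (auto simp: fun_scale_def fun_eq_iff algebra_simps)

definition cofactor_spanning :: "nat \<Rightarrow> nat \<Rightarrow> (nat \<Rightarrow> real \<times> real) \<Rightarrow> nat set set \<Rightarrow> bool" where
  "cofactor_spanning d n q E \<longleftrightarrow>
     E \<subseteq> complete_graph n \<and>
     fun_space.span (cofactor_matrix d q ` E) =
     fun_space.span (cofactor_matrix d q ` complete_graph n)"

text \<open>
  A dependence among the rows indexed by \<open>E\<close> is a coefficient function on \<open>E\<close>; the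
  values of \<open>l\<close> outside \<open>E\<close> are irrelevant.
\<close>

definition cofactor_dependence ::
    "nat \<Rightarrow> (nat \<Rightarrow> real \<times> real) \<Rightarrow> nat set set \<Rightarrow> (nat set \<Rightarrow> real) \<Rightarrow> bool" where
  "cofactor_dependence d q E l \<longleftrightarrow> (\<Sum>e\<in>E. fun_scale (l e) (cofactor_matrix d q e)) = 0"

definition nontrivial_on :: "nat set set \<Rightarrow> (nat set \<Rightarrow> real) \<Rightarrow> bool" where
  "nontrivial_on E l \<longleftrightarrow> (\<exists>e\<in>E. l e \<noteq> 0)"


definition line :: "real \<times> real \<Rightarrow> real \<times> real \<Rightarrow> (real \<times> real) set" where
  "line a b = affine hull {a, b}"

text \<open>The open side of the line \<open>ab\<close> containing the point \<open>p\<close>, which is assumed to be off the line.\<close>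

definition side_containing :: "real \<times> real \<Rightarrow> real \<times> real \<Rightarrow> real \<times> real \<Rightarrow> (real \<times> real) set" where
  "side_containing a b p = {r. closed_segment p r \<inter> line a b = {}}"

text \<open>For \<open>q\<close> in convex position, \<open>q 1\<close> and \<open>q 6\<close> lie on the same side of the line \<open>q 2 q 5\<close>.\<close>

definition upper_side :: "(nat \<Rightarrow> real \<times> real) \<Rightarrow> (real \<times> real) set" where
  "upper_side q = side_containing (q 2) (q 5) (q 1)"

definition lower_side :: "(nat \<Rightarrow> real \<times> real) \<Rightarrow> (real \<times> real) set" where
  "lower_side q = - line (q 2) (q 5) - upper_side q"

text \<open>The following three notions are meant for \<open>q\<close> in convex position.\<close>

definition positively_oriented :: "(nat \<Rightarrow> real \<times> real) \<Rightarrow> bool" where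
  "positively_oriented q \<longleftrightarrow>
     (\<exists>p. line (q 1) (q 4) \<inter> line (q 3) (q 6) = {p} \<and> p \<in> lower_side q)"

definition negatively_oriented :: "(nat \<Rightarrow> real \<times> real) \<Rightarrow> bool" where
  "negatively_oriented q \<longleftrightarrow>
     (\<exists>p. line (q 1) (q 4) \<inter> line (q 3) (q 6) = {p} \<and> p \<in> upper_side q)"

definition desargues_position :: "(nat \<Rightarrow> real \<times> real) \<Rightarrow> bool" where
  "desargues_position q \<longleftrightarrow>
     line (q 1) (q 4) \<inter> line (q 2) (q 5) \<inter> line (q 3) (q 6) \<noteq> {}"

end

theory Submission
  imports Defs
begin

text \<open>
  Write \<open>[abc]\<close> for the determinant (bracket) of the points \<open>a, b, c\<close>. Everything rests on one explicit
  dependence. Since \<open>c\<^sub>i\<^sub>j\<close> consists of the quadratic monomials in the direction \<open>q\<^sub>j - q\<^sub>i\<close>, Lagrange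
  interpolation of binary quadratic forms at four directions shows that on five vertices \<open>K\<close> the
  coefficients \<open>1 / (\<Prod>m\<in>K - {i, j}. [ijm])\<close>, for \<open>i < j\<close>, form a dependence of the complete graph
  (\<open>k5_stress_dependence\<close>); none of them vanishes.

  Spanning: such dependences on \<open>12345\<close> and \<open>12346\<close> express each of the two missing rows \<open>25\<close> and
  \<open>36\<close> through rows of \<open>G\<close>.

  Existence: \<open>[253]\<close> times the dependence on \<open>12345\<close> minus \<open>[256]\<close> times the one on \<open>12456\<close> cancels at
  \<open>25\<close> and never involves \<open>36\<close>, so it lives on \<open>G\<close> (\<open>hexagon_stress_dependence\<close>).

  Uniqueness and nonvanishing: any three of the vectors \<open>c\<^sub>v\<^sub>j\<close> at a vertex are independent, so at a
  vertex of degree four a single zero coefficient makes all four zero (\<open>four_valent_vertex_zero\<close>).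
  The vertices of degree four are \<open>2, 3, 5, 6\<close>; they span a 4-cycle of \<open>G\<close> and meet every edge
  except \<open>14\<close>. A zero at any edge other than \<open>14\<close> therefore spreads over all of \<open>G\<close>
  (\<open>hexagon_dependence_zero\<close>), and so two dependences that agree at one such edge coincide.

  Signs: if \<open>p\<close> lies on both lines \<open>14\<close> and \<open>36\<close>, then the numerator of the coefficient at \<open>14\<close> is
  \<open>[253][146] - [256][143] = [25p] ([146] + [134])\<close>, while the Pluecker relation turns that at \<open>15\<close>
  into the product \<open>[125][356]\<close>. In convex position all \<open>[ijk]\<close> with \<open>i < j < k\<close> have the same sign
  (\<open>convex_position_orientation\<close>), so the quotient of the two coefficients is a negative multiple of
  \<open>[251][25p]\<close>, whose sign tells on which side of the line \<open>25\<close> the point \<open>p\<close> lies.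
\<close>

section \<open>Brackets\<close>

definition bracket :: "real \<times> real \<Rightarrow> real \<times> real \<Rightarrow> real \<times> real \<Rightarrow> real" where
  "bracket a b c = (fst b - fst a) * (snd c - snd a) - (snd b - snd a) * (fst c - fst a)"

lemma bracket_rotate: "bracket b c a = bracket a b c"
  by (simp add: bracket_def algebra_simps)

lemma bracket_swap: "bracket b a c = - bracket a b c"
  by (simp add: bracket_def algebra_simps)

lemma bracket_swap_right: "bracket a c b = - bracket a b c"
  by (simp add: bracket_def algebra_simps)

lemma bracket_degenerate [simp]: "bracket a a b = 0" "bracket a b a = 0" "bracket a b b = 0"
  by (simp_all add: bracket_def algebra_simps)

lemma bracket_affine:
  "bracket a b ((1 - t) *\<^sub>R c + t *\<^sub>R d) = (1 - t) * bracket a b c + t * bracket a b d"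
  by (simp add: bracket_def algebra_simps)

lemma bracket_pluecker:
  "bracket v a b * bracket v c d - bracket v a c * bracket v b d + bracket v a d * bracket v b c = 0"
  by (simp add: bracket_def algebra_simps)

lemma mem_line_iff:
  assumes "a \<noteq> b"
  shows "r \<in> line a b \<longleftrightarrow> bracket a b r = 0"
proof
  assume "r \<in> line a b"
  then obtain u v where r: "r = u *\<^sub>R a + v *\<^sub>R b" "u + v = 1"
    by (auto simp: line_def affine_hull_2)
  have "u = 1 - v" using r(2) by simp
  then show "bracket a b r = 0" using r(1) by (simp add: bracket_affine)
next
  assume z: "bracket a b r = 0"
  let ?x = "fst b - fst a" and ?y = "snd b - snd a"
  define t where "t = (if ?x \<noteq> 0 then (fst r - fst a) / ?x else (snd r - snd a) / ?y)"
  have nz: "?x \<noteq> 0 \<or> ?y \<noteq> 0" using assms by (auto simp: prod_eq_iff)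
  have "fst r - fst a = t * ?x" "snd r - snd a = t * ?y"
    using z nz by (auto simp: t_def bracket_def field_simps)
  then have "r = (1 - t) *\<^sub>R a + t *\<^sub>R b" by (simp add: prod_eq_iff algebra_simps)
  then show "r \<in> line a b"
    unfolding line_def affine_hull_2
    by (intro CollectI exI[of _ "1 - t"] exI[of _ t]) simp
qed

lemma collinear_if_bracket_zero:
  assumes "bracket a b c = 0"
  shows "collinear {a, b, c}"
proof (cases "a = b")
  case False
  then show ?thesis
    using assms mem_line_iff[of a b c] collinear_3_affine_hull[of a b c] by (simp add: line_def)
qed simp

lemma general_position_bracket:
  assumes "general_position n q" "i \<in> {1..n}" "j \<in> {1..n}" "k \<in> {1..n}" "i \<noteq> j" "i \<noteq> k" "j \<noteq> k"
  shows "bracket (q i) (q j) (q k) \<noteq> 0"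
  using assms collinear_if_bracket_zero unfolding general_position_def by blast


section \<open>Dependences as balance conditions at the vertices\<close>

text \<open>
  The row of an edge has opposite signs in its two blocks. Moving this sign to the coefficient makes
  the equations at all vertices look alike.
\<close>

definition oriented :: "(nat set \<Rightarrow> real) \<Rightarrow> nat \<Rightarrow> nat \<Rightarrow> real" where
  "oriented l v j = (if v < j then l {v, j} else - l {v, j})"

definition balanced :: "(nat \<Rightarrow> real \<times> real) \<Rightarrow> nat set set \<Rightarrow> (nat set \<Rightarrow> real) \<Rightarrow> nat \<Rightarrow> bool" where
  "balanced q E l v \<longleftrightarrow>
     (\<forall>k. (\<Sum>j | {v, j} \<in> E. oriented l v j * cofactor_vector 3 (q v) (q j) k) = 0)"

lemma finite_complete_graph: "finite (complete_graph n)"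
  unfolding complete_graph_def by (rule finite_subset[of _ "Pow {1..n}"]) auto

lemma doubleton_mem_complete_graph:
  "{i, j} \<in> complete_graph n \<longleftrightarrow> i \<in> {1..n} \<and> j \<in> {1..n} \<and> i \<noteq> j"
  by (auto simp: complete_graph_def card_insert_if)

lemma complete_graph_elem:
  assumes "e \<in> complete_graph n" "v \<in> e"
  obtains j where "e = {v, j}" "j \<noteq> v"
  using assms by (auto simp: complete_graph_def card_2_iff)

lemma cofactor_vector_3_commute: "cofactor_vector 3 a b k = cofactor_vector 3 b a k"
proof -
  consider "k = 0" | "k = 1" | "k = 2" | "k \<ge> 3" by linarith
  then show ?thesis
    by cases (simp_all add: cofactor_vector_def power2_commute algebra_simps)
qed

lemma dependence_pointwise:
  "cofactor_dependence d q E l \<longleftrightarrow> (\<forall>v k. (\<Sum>e\<in>E. l e * cofactor_matrix d q e (v, k)) = 0)"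
proof -
  have apply_sum: "(\<Sum>e\<in>E. fun_scale (l e) (cofactor_matrix d q e)) x
      = (\<Sum>e\<in>E. l e * cofactor_matrix d q e x)" for x
    by (induction E rule: infinite_finite_induct) (auto simp: fun_scale_def)
  show ?thesis
    unfolding cofactor_dependence_def fun_eq_iff apply_sum by auto
qed

text \<open>
  Only the edges at \<open>v\<close> contribute to the columns of \<open>v\<close>. Because the entries of the vectors are
  quadratic, they do not depend on the order of the two end points, so the order enters through the
  sign in \<^const>\<open>oriented\<close> alone.
\<close>

lemma dependence_iff_balanced:
  assumes E: "E \<subseteq> complete_graph n"
  shows "cofactor_dependence 3 q E l \<longleftrightarrow> (\<forall>v. balanced q E l v)"
proof -
  have "(\<Sum>e\<in>E. l e * cofactor_matrix 3 q e (v, k))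
      = (\<Sum>j | {v, j} \<in> E. oriented l v j * cofactor_vector 3 (q v) (q j) k)" for v k
  proof -
    have fin: "finite E" using E finite_complete_graph finite_subset by blast
    have image: "{e \<in> E. v \<in> e} = (\<lambda>j. {v, j}) ` {j. {v, j} \<in> E}"
    proof -
      have "e \<in> (\<lambda>j. {v, j}) ` {j. {v, j} \<in> E}" if "e \<in> E" "v \<in> e" for e
        using that E complete_graph_elem[of e n v] by blast
      then show ?thesis by auto
    qed
    have "(\<Sum>e\<in>E. l e * cofactor_matrix 3 q e (v, k))
        = (\<Sum>e | e \<in> E \<and> v \<in> e. l e * cofactor_matrix 3 q e (v, k))"
    proof (rule sum.mono_neutral_right[OF fin], safe)
      fix e assume e: "e \<in> E" "l e * cofactor_matrix 3 q e (v, k) \<noteq> 0"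
      have "finite e" "e \<noteq> {}" using e(1) E by (auto simp: complete_graph_def intro: finite_subset)
      then have "Min e \<in> e" "Max e \<in> e" by auto
      then show "v \<in> e" using e(2) by (auto simp: cofactor_matrix_def split: if_splits)
    qed
    also have "\<dots> = (\<Sum>j | {v, j} \<in> E. l {v, j} * cofactor_matrix 3 q {v, j} (v, k))"
      unfolding image by (subst sum.reindex) (auto simp: inj_on_def doubleton_eq_iff)
    also have "\<dots> = (\<Sum>j | {v, j} \<in> E. oriented l v j * cofactor_vector 3 (q v) (q j) k)"
    proof (rule sum.cong)
      fix j assume "j \<in> {j. {v, j} \<in> E}"
      then have "v \<noteq> j" using E doubleton_mem_complete_graph by auto
      then show "l {v, j} * cofactor_matrix 3 q {v, j} (v, k)
          = oriented l v j * cofactor_vector 3 (q v) (q j) k"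
        using cofactor_vector_3_commute[of "q v" "q j" k]
        by (auto simp: cofactor_matrix_def oriented_def min_def max_def)
    qed simp
    finally show ?thesis .
  qed
  then show ?thesis unfolding dependence_pointwise balanced_def by simp
qed

text \<open>
  The columns of \<open>v\<close> hold the three quadratic monomials of the edge direction, so balance at \<open>v\<close>
  annihilates every quadratic form. The forms that split into two linear factors let one delete
  the edges in two chosen directions.
\<close>

lemma balanced_quadratic:
  assumes "balanced q E l v"
  shows "(\<Sum>j | {v, j} \<in> E. oriented l v j * (bracket (q v) p (q j) * bracket (q v) r (q j))) = 0"
proof -
  let ?px = "fst p - fst (q v)" and ?py = "snd p - snd (q v)"
  let ?rx = "fst r - fst (q v)" and ?ry = "snd r - snd (q v)"
  let ?c = "\<lambda>k j. oriented l v j * cofactor_vector 3 (q v) (q j) k"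
  have "oriented l v j * (bracket (q v) p (q j) * bracket (q v) r (q j))
      = ?py * ?ry * ?c 0 j - (?px * ?ry + ?py * ?rx) * ?c 1 j + ?px * ?rx * ?c 2 j" for j
    by (simp add: bracket_def cofactor_vector_def power2_eq_square algebra_simps)
  moreover have "(\<Sum>j | {v, j} \<in> E. ?c k j) = 0" for k
    using assms unfolding balanced_def by blast
  ultimately show ?thesis
    by (simp only: sum.distrib sum_subtractf sum_distrib_left[symmetric] mult_zero_right diff_zero add_0)
qed

text \<open>
  Four equilibrium coefficients in a three-dimensional space, any three of whose vectors are
  independent, are all zero as soon as one is.
\<close>

lemma four_valent_vertex_zero:
  assumes gp: "general_position n q" and E: "E \<subseteq> complete_graph n"
    and dep: "cofactor_dependence 3 q E l"
    and nb: "card {j. {v, j} \<in> E} = 4"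
    and a: "{v, a} \<in> E" "l {v, a} = 0" and b: "{v, b} \<in> E"
  shows "l {v, b} = 0"
proof (cases "b = a")
  case False
  let ?N = "{j. {v, j} \<in> E}"
  have fin: "finite ?N" using nb card.infinite by fastforce
  have ab: "a \<in> ?N" "b \<in> ?N" using a b by auto
  then have "card (?N - {a, b}) = 2"
    using nb False fin by (simp add: card_Diff_subset)
  then obtain c d where cd: "?N - {a, b} = {c, d}" "c \<noteq> d" by (auto simp: card_2_iff)
  have "?N = {a, b} \<union> (?N - {a, b})" using ab by blast
  then have N: "?N = {a, b, c, d}" by (simp only: cd(1) Un_insert_left Un_empty_left)
  have inV: "j \<in> {1..n} \<and> j \<noteq> v" if "j \<in> ?N" for j
  proof -
    have "{v, j} \<in> complete_graph n" using that E by blast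
    then show ?thesis by (auto simp: doubleton_mem_complete_graph)
  qed
  have V: "{a, b, c, d} \<subseteq> {1..n} - {v}" using inV unfolding N by blast
  have v: "v \<in> {1..n}" using subsetD[OF E a(1)] by (simp add: doubleton_mem_complete_graph)
  have ne: "b \<noteq> c" "b \<noteq> d" "a \<noteq> c" "a \<noteq> d" using cd by auto
  \<comment> \<open>The form vanishing in the directions of \<open>c\<close> and \<open>d\<close> isolates the other two edges.\<close>
  have "(\<Sum>j\<in>{a, b, c, d}. oriented l v j *
      (bracket (q v) (q c) (q j) * bracket (q v) (q d) (q j))) = 0"
    using balanced_quadratic[of q E l v "q c" "q d"] dep dependence_iff_balanced[OF E]
    unfolding N by blast
  moreover have a0: "oriented l v a = 0" using a(2) by (simp add: oriented_def)
  ultimately have "oriented l v b * (bracket (q v) (q c) (q b) * bracket (q v) (q d) (q b)) = 0"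
    using False ne cd(2) by (simp add: a0)
  moreover have "bracket (q v) (q c) (q b) \<noteq> 0" "bracket (q v) (q d) (q b) \<noteq> 0"
    by (rule general_position_bracket[OF gp]; use V v ne in blast)+
  ultimately show ?thesis by (simp add: oriented_def split: if_splits)
qed (use a in simp)

section \<open>The dependence of a complete graph on five vertices\<close>

text \<open>
  Homogeneous Lagrange interpolation: the third divided difference of a quadratic form is zero.
\<close>

lemma lagrange_four_directions:
  fixes x y :: "'a \<Rightarrow> real" and f :: "real \<Rightarrow> real \<Rightarrow> real"
  defines "D \<equiv> \<lambda>i j. x i * y j - y i * x j"
  assumes f: "\<And>s t. f s t = \<alpha> * s ^ 2 + \<beta> * s * t + \<gamma> * t ^ 2"
    and nz: "D a b \<noteq> 0" "D a c \<noteq> 0" "D a d \<noteq> 0" "D b c \<noteq> 0" "D b d \<noteq> 0" "D c d \<noteq> 0"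
  shows "f (x a) (y a) / (D a b * D a c * D a d) + f (x b) (y b) / (D b a * D b c * D b d)
       + f (x c) (y c) / (D c a * D c b * D c d) + f (x d) (y d) / (D d a * D d b * D d c) = 0"
proof -
  have anti: "D i j = - D j i" for i j by (simp add: D_def)
  have main: "f (x a) (y a) * (D b c * D b d * D c d) - f (x b) (y b) * (D a c * D a d * D c d)
      + f (x c) (y c) * (D a b * D a d * D b d) - f (x d) (y d) * (D a b * D a c * D b c) = 0"
    unfolding f D_def by algebra
  show ?thesis
    unfolding anti[of b a] anti[of c a] anti[of c b] anti[of d a] anti[of d b] anti[of d c]
    using nz main by (simp add: divide_simps) algebra
qed

text \<open>
  Extended by zero to edges outside \<open>K\<close>, so that the dependences for different \<open>K\<close> can be combined
  on one complete graph.
\<close>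

definition k5_stress :: "(nat \<Rightarrow> real \<times> real) \<Rightarrow> nat set \<Rightarrow> nat set \<Rightarrow> real" where
  "k5_stress q K e =
     (if e \<subseteq> K then 1 / (\<Prod>m\<in>K - e. bracket (q (Min e)) (q (Max e)) (q m)) else 0)"

text \<open>
  Interchanging \<open>v\<close> and \<open>j\<close> changes the sign of each of the three brackets, hence of their product.
  This is exactly the sign in \<^const>\<open>oriented\<close>, so the formula holds for both orders.
\<close>

lemma oriented_k5_stress:
  assumes "card K = 5" "v \<in> K" "j \<in> K" "v \<noteq> j"
  shows "oriented (k5_stress q K) v j = 1 / (\<Prod>m\<in>K - {v, j}. bracket (q v) (q j) (q m))"
proof (cases "v < j")
  case True
  then have "Min {v, j} = v" "Max {v, j} = j" by auto
  with True assms(2,3) show ?thesis by (simp add: oriented_def k5_stress_def)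
next
  case False
  have "finite K" using assms(1) card.infinite by fastforce
  then have "card (K - {v, j}) = 3" using assms by (simp add: card_Diff_subset)
  then have "(\<Prod>m\<in>K - {v, j}. bracket (q j) (q v) (q m))
      = - (\<Prod>m\<in>K - {v, j}. bracket (q v) (q j) (q m))"
    unfolding bracket_swap[of "q j" "q v"] by (simp add: prod_uminus)
  moreover have "Min {v, j} = j" "Max {v, j} = v" using False by auto
  ultimately show ?thesis using assms(2,3) False by (simp add: oriented_def k5_stress_def)
qed

text \<open>
  At a vertex \<open>v\<close> of \<open>K\<close> the weights are the Lagrange weights of the directions from \<open>v\<close> to the
  other four points.
\<close>

lemma k5_stress_dependence:
  assumes gp: "general_position n q" and K: "K \<subseteq> {1..n}" "card K = 5"
  shows "cofactor_dependence 3 q (complete_graph n) (k5_stress q K)"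
  unfolding dependence_iff_balanced[OF subset_refl]
proof (intro allI, unfold balanced_def, intro allI)
  fix v k
  let ?t = "\<lambda>j. oriented (k5_stress q K) v j * cofactor_vector 3 (q v) (q j) k"
  let ?N = "{j. {v, j} \<in> complete_graph n}"
  have fin: "finite K" using K(1) finite_subset by blast
  show "sum ?t ?N = 0"
  proof (cases "v \<in> K \<and> k < 3")
    case False
    have "?t j = 0" for j
      using False by (auto simp: oriented_def k5_stress_def cofactor_vector_def)
    then show ?thesis by (intro sum.neutral ballI)
  next
    case True
    then have "card (K - {v}) = 4" using K by simp
    then obtain a b c d where abcd: "K - {v} = {a, b, c, d}"
        "a \<noteq> b" "a \<noteq> c" "a \<noteq> d" "b \<noteq> c" "b \<noteq> d" "c \<noteq> d"
      by (auto simp: card_Suc_eq numeral_eq_Suc)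
    then have Kv: "K = {v, a, b, c, d}" and nv: "v \<noteq> a" "v \<noteq> b" "v \<noteq> c" "v \<noteq> d"
      using True by auto
    have "sum ?t ?N = sum ?t (K - {v})"
    proof (rule sum.mono_neutral_right)
      show "finite ?N" by (rule finite_subset[of _ "{1..n}"]) (auto simp: doubleton_mem_complete_graph)
      show "K - {v} \<subseteq> ?N" using K True by (auto simp: doubleton_mem_complete_graph)
      show "\<forall>j\<in>?N - (K - {v}). ?t j = 0"
        by (auto simp: doubleton_mem_complete_graph oriented_def k5_stress_def)
    qed
    also have "\<dots> = 0"
    proof -
      let ?x = "\<lambda>j. fst (q j) - fst (q v)" and ?y = "\<lambda>j. snd (q j) - snd (q v)"
      have br: "bracket (q v) (q i) (q j) = ?x i * ?y j - ?y i * ?x j" for i j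
        by (simp add: bracket_def)
      have nz: "?x i * ?y j - ?y i * ?x j \<noteq> 0" if "i \<in> K - {v}" "j \<in> K - {v}" "i \<noteq> j" for i j
        unfolding br[symmetric]
        by (rule general_position_bracket[OF gp]) (use that K(1) True in blast)+
      \<comment> \<open>The quadratic monomial in column \<open>k\<close>, as a form with explicit coefficients.\<close>
      define f where "f s t = (if k = 0 then 1 else 0) * s ^ 2
          + (if k = 1 then 1 else 0) * s * t + (if k = 2 then 1 else 0) * t ^ 2" for s t :: real
      have "k = 0 \<or> k = 1 \<or> k = 2" using True by linarith
      then have cf: "cofactor_vector 3 (q v) (q j) k = f (?x j) (?y j)" for j
        by (auto simp: cofactor_vector_def f_def power2_eq_square algebra_simps)
      have w: "oriented (k5_stress q K) v j
          = 1 / (\<Prod>m\<in>K - {v, j}. ?x j * ?y m - ?y j * ?x m)" if "j \<in> K - {v}" for j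
        using oriented_k5_stress[of K v j q] that True K(2) unfolding br by auto
      have rest: "K - {v, a} = {b, c, d}" "K - {v, b} = {a, c, d}"
          "K - {v, c} = {a, b, d}" "K - {v, d} = {a, b, c}"
        using Kv nv abcd(2-) by auto
      have "sum ?t (K - {v}) = ?t a + ?t b + ?t c + ?t d"
        using abcd by (simp add: add.assoc)
      also have "\<dots> = 0"
        using lagrange_four_directions[of f _ _ _ ?x a ?y b c d, OF f_def] nz
        unfolding abcd(1) by (simp add: w abcd(1) rest cf abcd(2-) mult.assoc)
      finally show ?thesis .
    qed
    finally show ?thesis .
  qed
qed

lemma k5_stress_nonzero:
  assumes gp: "general_position n q" and K: "K \<subseteq> {1..n}"
    and ij: "i \<in> K" "j \<in> K" "i < j"
  shows "k5_stress q K {i, j} \<noteq> 0"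
proof -
  have "finite K" using K finite_subset by blast
  moreover have "bracket (q i) (q j) (q m) \<noteq> 0" if "m \<in> K - {i, j}" for m
    by (rule general_position_bracket[OF gp]) (use that ij K in blast)+
  ultimately show ?thesis using ij by (simp add: k5_stress_def min_def max_def)
qed


section \<open>Spans and linear combinations\<close>

lemma dependence_linear:
  assumes "cofactor_dependence d q E l" "cofactor_dependence d q E m"
  shows "cofactor_dependence d q E (\<lambda>e. s * l e - t * m e)"
proof -
  have "(\<Sum>e\<in>E. (s * l e - t * m e) * cofactor_matrix d q e x)
      = s * (\<Sum>e\<in>E. l e * cofactor_matrix d q e x) - t * (\<Sum>e\<in>E. m e * cofactor_matrix d q e x)" for x
    by (simp add: algebra_simps sum_subtractf sum_distrib_left)
  then show ?thesis using assms unfolding dependence_pointwise by simp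
qed

lemma dependence_restrict:
  assumes "cofactor_dependence d q E l" "finite E" "F \<subseteq> E" "\<And>e. e \<in> E - F \<Longrightarrow> l e = 0"
  shows "cofactor_dependence d q F l"
proof -
  have "(\<Sum>e\<in>E. fun_scale (l e) (cofactor_matrix d q e))
      = (\<Sum>e\<in>F. fun_scale (l e) (cofactor_matrix d q e))"
    using assms(2-4) by (intro sum.mono_neutral_right) (auto simp: fun_scale_def)
  then show ?thesis using assms(1) unfolding cofactor_dependence_def by simp
qed

text \<open>Solving a dependence for a row with nonzero coefficient.\<close>

lemma row_in_span:
  assumes dep: "cofactor_dependence d q E l" and fin: "finite E"
    and e: "e \<in> E" "l e \<noteq> 0"
    and F: "\<And>f. f \<in> E \<Longrightarrow> f \<noteq> e \<Longrightarrow> l f \<noteq> 0 \<Longrightarrow> f \<in> F"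
  shows "cofactor_matrix d q e \<in> fun_space.span (cofactor_matrix d q ` F)"
proof -
  let ?t = "\<lambda>f. fun_scale (l f) (cofactor_matrix d q f)"
  have "?t e + sum ?t (E - {e}) = 0"
    using dep sum.remove[OF fin e(1), of ?t] unfolding cofactor_dependence_def by simp
  then have eq: "?t e = - sum ?t (E - {e})" by (simp add: eq_neg_iff_add_eq_0)
  have "?t f \<in> fun_space.span (cofactor_matrix d q ` F)" if "f \<in> E - {e}" for f
  proof (cases "l f = 0")
    case True
    then have zero: "?t f = 0" by (simp add: fun_scale_def fun_eq_iff)
    show ?thesis unfolding zero by (rule fun_space.span_zero)
  next
    case False
    then have "f \<in> F" using F that by auto
    then show ?thesis by (intro fun_space.span_scale fun_space.span_base) auto
  qed
  then have "?t e \<in> fun_space.span (cofactor_matrix d q ` F)"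
    unfolding eq by (intro fun_space.span_neg fun_space.span_sum)
  then have "fun_scale (1 / l e) (?t e) \<in> fun_space.span (cofactor_matrix d q ` F)"
    by (rule fun_space.span_scale)
  moreover have "fun_scale (1 / l e) (?t e) = cofactor_matrix d q e"
    using e(2) by (simp add: fun_scale_def fun_eq_iff)
  ultimately show ?thesis by simp
qed


section \<open>The orientation of a convex polygon\<close>

text \<open>
  If \<open>c\<close> and \<open>d\<close> were on opposite sides, the segment \<open>cd\<close> would cross the line \<open>ab\<close> in a point of \<open>S\<close>.
  A face is the intersection of \<open>S\<close> with its affine hull, so this point lies in the face, which then
  contains \<open>c\<close> as well, although \<open>c\<close> is off the line.
\<close>

lemma edge_of_same_side:
  assumes edge: "closed_segment a b edge_of S" and S: "convex S"
    and cd: "c \<in> S" "d \<in> S"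
    and nz: "bracket a b c \<noteq> 0" "bracket a b d \<noteq> 0"
  shows "bracket a b c * bracket a b d > 0"
proof (rule ccontr)
  assume "\<not> ?thesis"
  then have opp: "bracket a b c * bracket a b d < 0"
    using nz by (simp add: not_less le_less)
  have face: "closed_segment a b face_of S" using edge by (simp add: edge_of_def)
  have hull: "affine hull closed_segment a b = line a b"
    by (simp add: line_def segment_convex_hull affine_hull_convex_hull)
  have segment: "closed_segment a b = line a b \<inter> S"
    using face_of_imp_eq_affine_Int[OF S face] unfolding hull .
  have ab: "a \<noteq> b" using nz by auto
  \<comment> \<open>The parameter at which the affine function \<open>bracket a b\<close> vanishes on the segment.\<close>
  define t where "t = bracket a b c / (bracket a b c - bracket a b d)"
  have dne: "bracket a b c - bracket a b d \<noteq> 0"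
    using opp by (auto simp: mult_less_0_iff)
  have t: "0 < t" "t < 1"
    using opp dne by (auto simp: t_def mult_less_0_iff field_simps zero_less_divide_iff divide_less_eq)
  define x where "x = (1 - t) *\<^sub>R c + t *\<^sub>R d"
  have "bracket a b x = 0"
    unfolding x_def bracket_affine using dne by (simp add: t_def field_simps)
  then have "x \<in> line a b" using mem_line_iff[OF ab] by simp
  moreover have open_seg: "x \<in> open_segment c d"
    unfolding in_segment x_def using t opp by (auto intro!: exI[of _ t])
  moreover have "x \<in> S"
    using open_seg cd S by (meson closed_segment_subset open_closed_segment subsetD)
  ultimately have "x \<in> closed_segment a b"
    using segment by blast
  then have "c \<in> closed_segment a b"
    using face cd open_seg unfolding face_of_def by blast
  then have "c \<in> line a b" using segment by blast
  then show False using mem_line_iff[OF ab] nz by simp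
qed

text \<open>
  Each edge from \<open>q i\<close> to \<open>q (i + 1)\<close> has all other vertices on one side, and \<open>[i, i+1, i+2] = [i+1, i+2, i]\<close> carries the
  sign of this side from one edge to the next. For general \<open>i < j < k\<close> the sign follows by induction
  on \<open>k\<close> from the Pluecker relation with base point \<open>i\<close> applied to \<open>i + 1, j, k, k + 1\<close>.
\<close>

lemma convex_position_orientation:
  assumes gp: "general_position n q" and conv: "convex_position n q"
  obtains s where "s = 1 \<or> s = (- 1 :: real)"
    "\<And>i j k. 1 \<le> i \<Longrightarrow> i < j \<Longrightarrow> j < k \<Longrightarrow> k \<le> n \<Longrightarrow> s * bracket (q i) (q j) (q k) > 0"
proof -
  let ?B = "\<lambda>i j k. bracket (q i) (q j) (q k)"
  have n: "3 \<le> n" using conv by (simp add: convex_position_def)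
  have nz: "?B i j k \<noteq> 0" if "{i, j, k} \<subseteq> {1..n}" "i \<noteq> j" "i \<noteq> k" "j \<noteq> k" for i j k
    using general_position_bracket[OF gp] that by auto
  have side: "?B i (Suc i) k * ?B i (Suc i) m > 0"
    if "{i, k, m} \<subseteq> {1..n}" "i < n" "k \<notin> {i, Suc i}" "m \<notin> {i, Suc i}" for i k m
  proof (rule edge_of_same_side)
    have "i \<in> {1..n}" "i \<noteq> n" using that by auto
    then show "closed_segment (q i) (q (Suc i)) edge_of convex hull (q ` {1..n})"
      using conv unfolding convex_position_def by fastforce
    show "q k \<in> convex hull (q ` {1..n})" "q m \<in> convex hull (q ` {1..n})"
      using that by (auto intro!: hull_inc)
  qed (use that nz in auto)
  define s where "s = sgn (?B 1 2 3)"
  have "?B 1 2 3 \<noteq> 0" using nz[of 1 2 3] n by auto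
  then have s: "s = 1 \<or> s = - 1" "s * ?B 1 2 3 > 0"
    by (auto simp: s_def sgn_if)
  have consec: "s * ?B i (Suc i) (Suc (Suc i)) > 0" if "1 \<le> i" "Suc (Suc i) \<le> n" for i
    using that
  proof (induction i rule: dec_induct)
    case base
    then show ?case using s(2) by (simp add: numeral_eq_Suc)
  next
    case (step i)
    have "?B (Suc i) (Suc (Suc i)) i * ?B (Suc i) (Suc (Suc i)) (Suc (Suc (Suc i))) > 0"
      using step.hyps step.prems by (intro side) auto
    moreover have "s * ?B (Suc i) (Suc (Suc i)) i > 0"
      using step.IH step.prems bracket_rotate[of "q (Suc i)" "q (Suc (Suc i))" "q i"] by simp
    ultimately show ?case by (auto simp: zero_less_mult_iff)
  qed
  have adjacent: "s * ?B i (Suc i) k > 0" if "1 \<le> i" "i < n" "1 \<le> k" "k \<le> n" "k \<notin> {i, Suc i}" for i k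
  \<comment> \<open>The last edge has no vertex \<open>i + 2\<close>; its sign comes from the vertex before it.\<close>
  proof (cases "Suc i = n")
    case False
    then have "s * ?B i (Suc i) (Suc (Suc i)) > 0" using that by (intro consec) auto
    moreover have "?B i (Suc i) (Suc (Suc i)) * ?B i (Suc i) k > 0"
      using that False by (intro side) auto
    ultimately show ?thesis by (auto simp: zero_less_mult_iff)
  next
    case True
    then obtain h where h: "i = Suc h" "1 \<le> h" using n that(1) by (cases i) auto
    have "s * ?B h i n > 0" using consec[of h] h True by simp
    then have "s * ?B i (Suc i) h > 0"
      using bracket_rotate[of "q i" "q n" "q h"] True by simp
    moreover have "?B i (Suc i) h * ?B i (Suc i) k > 0"
      using that h True by (intro side) auto
    ultimately show ?thesis by (auto simp: zero_less_mult_iff)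
  qed
  have "s * ?B i j k > 0" if "1 \<le> i" "i < j" "Suc j \<le> k" "k \<le> n" for i j k
    using that(3,4)
  proof (induction k rule: dec_induct)
    case base
    have "s * ?B j (Suc j) i > 0" using that base by (intro adjacent) auto
    then show ?case by (simp add: bracket_rotate[of "q j" "q (Suc j)" "q i"])
  next
    case (step k)
    show ?case
    proof (cases "j = Suc i")
      case True
      then show ?thesis using adjacent[of i "Suc k"] that step by simp
    next
      case False
      let ?e = "Suc i"
      have pos: "s * ?B i ?e j > 0" "s * ?B i ?e k > 0" "s * ?B i ?e (Suc k) > 0"
        using that step False by (auto intro!: adjacent)
      have "s * ?B k (Suc k) i > 0" using that step by (intro adjacent) auto
      then have last: "s * ?B i k (Suc k) > 0"
        by (simp add: bracket_rotate[of "q k" "q (Suc k)" "q i"])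
      have IH: "s * ?B i j k > 0" using step by simp
      have ss: "s * s = 1" using s(1) by auto
      have "(s * ?B i ?e k) * (s * ?B i j (Suc k))
          = (s * ?B i ?e j) * (s * ?B i k (Suc k)) + (s * ?B i ?e (Suc k)) * (s * ?B i j k)"
        using bracket_pluecker[of "q i" "q ?e" "q j" "q k" "q (Suc k)"] ss by algebra
      also have "\<dots> > 0" by (rule add_pos_pos) (rule mult_pos_pos; fact)+
      finally show ?thesis using pos(2) by (simp add: zero_less_mult_iff)
    qed
  qed
  then have "s * ?B i j k > 0" if "1 \<le> i" "i < j" "j < k" "k \<le> n" for i j k
    using that by (simp add: Suc_le_eq)
  with s(1) show ?thesis by (rule that)
qed

lemma mem_side_containing_iff:
  assumes "bracket a b p \<noteq> 0"
  shows "r \<in> side_containing a b p \<longleftrightarrow> bracket a b p * bracket a b r > 0"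
proof -
  have ab: "a \<noteq> b" using assms by auto
  let ?P = "bracket a b p" and ?R = "bracket a b r"
  show ?thesis
  proof
    assume side: "r \<in> side_containing a b p"
    show "?P * ?R > 0"
    proof (rule ccontr)
      assume "\<not> ?thesis"
      then have "?P * ?R \<le> 0" by simp
      then have opp: "(?P > 0 \<and> ?R \<le> 0) \<or> (?P < 0 \<and> ?R \<ge> 0)"
        using assms by (auto simp: mult_le_0_iff)
      define t where "t = ?P / (?P - ?R)"
      have t: "0 \<le> t" "t \<le> 1" using opp by (auto simp: t_def divide_simps)
      have "bracket a b ((1 - t) *\<^sub>R p + t *\<^sub>R r) = 0"
        unfolding bracket_affine using opp by (auto simp: t_def field_simps)
      then have "(1 - t) *\<^sub>R p + t *\<^sub>R r \<in> closed_segment p r \<inter> line a b"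
        using t mem_line_iff[OF ab] by (auto simp: in_segment)
      then show False using side by (auto simp: side_containing_def)
    qed
  next
    assume pos: "?P * ?R > 0"
    have "bracket a b x \<noteq> 0" if "x \<in> closed_segment p r" for x
    proof -
      obtain t where t: "x = (1 - t) *\<^sub>R p + t *\<^sub>R r" "0 \<le> t" "t \<le> 1"
        using \<open>x \<in> closed_segment p r\<close> by (auto simp: in_segment)
      have "?P * bracket a b x = (1 - t) * (?P * ?P) + t * (?P * ?R)"
        unfolding t(1) bracket_affine by (simp add: algebra_simps)
      moreover have "\<dots> > 0"
      proof (cases "t = 0")
        case True
        then show ?thesis using assms by (simp add: power2_eq_square[symmetric])
      next
        case False
        then have "t * (?P * ?R) > 0" "(1 - t) * (?P * ?P) \<ge> 0" using t pos by auto
        then show ?thesis by linarith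
      qed
      ultimately show ?thesis by auto
    qed
    then show "r \<in> side_containing a b p"
      using mem_line_iff[OF ab] by (auto simp: side_containing_def)
  qed
qed

text \<open>
  On the line \<open>cd\<close>, the point on the line \<open>ab\<close> has affine weights proportional to \<open>[abd]\<close> and \<open>- [abc]\<close>,
  and \<open>[ef_]\<close> is an affine function.
\<close>

lemma bracket_at_intersection:
  assumes ab: "a \<noteq> b" and cd: "c \<noteq> d" and p: "p \<in> line a b" "p \<in> line c d"
  shows "bracket e f p * (bracket a b d - bracket a b c)
       = bracket e f c * bracket a b d - bracket e f d * bracket a b c"
proof -
  obtain u t where "p = u *\<^sub>R c + t *\<^sub>R d" "u + t = 1"
    using p(2) by (auto simp: line_def affine_hull_2)
  moreover from this have "u = 1 - t" by simp
  ultimately have pt: "p = (1 - t) *\<^sub>R c + t *\<^sub>R d" by simp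
  have "(1 - t) * bracket a b c + t * bracket a b d = 0"
    using p(1) mem_line_iff[OF ab, of p] unfolding pt bracket_affine by simp
  then show ?thesis unfolding pt bracket_affine by algebra
qed

section \<open>The graph K6 without the edges 25 and 36\<close>

definition hexagon_graph :: "nat set set" where
  "hexagon_graph = complete_graph 6 - {{2, 5}, {3, 6}}"

text \<open>The factors are chosen so that the two contributions at the edge \<open>25\<close> cancel.\<close>

definition hexagon_stress :: "(nat \<Rightarrow> real \<times> real) \<Rightarrow> nat set \<Rightarrow> real" where
  "hexagon_stress q e = bracket (q 2) (q 5) (q 3) * k5_stress q {1, 2, 3, 4, 5} e
     - bracket (q 2) (q 5) (q 6) * k5_stress q {1, 2, 4, 5, 6} e"

lemma hexagon_graph_subset: "hexagon_graph \<subseteq> complete_graph 6"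
  by (auto simp: hexagon_graph_def)

lemma doubleton_mem_hexagon_graph:
  "{i, j} \<in> hexagon_graph \<longleftrightarrow>
     i \<in> {1, 2, 3, 4, 5, 6} \<and> j \<in> {1, 2, 3, 4, 5, 6} \<and> i \<noteq> j \<and>
     (i, j) \<notin> {(2, 5), (5, 2), (3, 6), (6, 3)}"
proof -
  have "{1..6} = {1, 2, 3, 4, 5, 6 :: nat}" by auto
  then show ?thesis
    by (auto simp: hexagon_graph_def doubleton_mem_complete_graph doubleton_eq_iff)
qed

lemma hexagon_graph_cases:
  assumes "e \<in> hexagon_graph"
  obtains i j where "e = {i, j}" "{i, j} \<in> hexagon_graph" "i < j"
proof -
  have "card e = 2" using assms by (auto simp: hexagon_graph_def complete_graph_def)
  then obtain i j where "e = {i, j}" "i \<noteq> j" by (auto simp: card_2_iff)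
  then show ?thesis using that assms by (metis insert_commute linorder_neqE_nat)
qed

text \<open>
  The vertex sets \<open>12345\<close> and \<open>12346\<close> contain the edge \<open>25\<close> resp. \<open>36\<close> and not the other one, so their
  dependences can be solved for the missing row.
\<close>

lemma hexagon_spanning:
  assumes gp: "general_position 6 q"
  shows "cofactor_spanning 3 6 q hexagon_graph"
proof -
  let ?M = "cofactor_matrix 3 q"
  have row: "?M {i, j} \<in> fun_space.span (?M ` hexagon_graph)"
    if K: "K \<subseteq> {1..6}" "card K = 5" and ij: "i \<in> K" "j \<in> K" "i < j"
      and other: "\<And>e. e \<subseteq> K \<Longrightarrow> e \<in> {{2, 5}, {3, 6}} \<Longrightarrow> e = {i, j}" for K i j
  proof (rule row_in_span[OF k5_stress_dependence[OF gp K] finite_complete_graph])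
    show "{i, j} \<in> complete_graph 6" using K ij by (auto simp: doubleton_mem_complete_graph)
    show "k5_stress q K {i, j} \<noteq> 0" using k5_stress_nonzero[OF gp K(1) ij] .
    show "f \<in> hexagon_graph"
      if "f \<in> complete_graph 6" "f \<noteq> {i, j}" "k5_stress q K f \<noteq> 0" for f
      using that other[of f] by (auto simp: hexagon_graph_def k5_stress_def split: if_splits)
  qed
  have "?M {2, 5} \<in> fun_space.span (?M ` hexagon_graph)"
    by (rule row[of "{1, 2, 3, 4, 5}"]) auto
  moreover have "?M {3, 6} \<in> fun_space.span (?M ` hexagon_graph)"
    by (rule row[of "{1, 2, 3, 4, 6}"]) auto
  ultimately have "?M ` complete_graph 6 \<subseteq> fun_space.span (?M ` hexagon_graph)"
    by (auto simp: hexagon_graph_def intro: fun_space.span_base)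
  then have "fun_space.span (?M ` complete_graph 6) \<subseteq> fun_space.span (?M ` hexagon_graph)"
    by (intro fun_space.span_minimal) (auto simp: fun_space.subspace_span)
  moreover have "fun_space.span (?M ` hexagon_graph) \<subseteq> fun_space.span (?M ` complete_graph 6)"
    by (intro fun_space.span_mono image_mono hexagon_graph_subset)
  ultimately show ?thesis
    using hexagon_graph_subset by (auto simp: cofactor_spanning_def)
qed

lemma hexagon_stress_dependence:
  assumes gp: "general_position 6 q"
  shows "cofactor_dependence 3 q hexagon_graph (hexagon_stress q)"
proof (rule dependence_restrict[OF _ finite_complete_graph hexagon_graph_subset])
  show "cofactor_dependence 3 q (complete_graph 6) (hexagon_stress q)"
    unfolding hexagon_stress_def[abs_def]
    by (intro dependence_linear k5_stress_dependence[OF gp]) auto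
  fix e assume "e \<in> complete_graph 6 - hexagon_graph"
  then consider "e = {2, 5}" | "e = {3, 6}" by (auto simp: hexagon_graph_def)
  then show "hexagon_stress q e = 0"
  proof cases
    case 1
    have nz: "bracket (q 2) (q 5) (q m) \<noteq> 0" if "m \<in> {1, 3, 4, 6}" for m
      using general_position_bracket[OF gp] that by auto
    have "{1, 2, 3, 4, 5} - {2, 5} = {1, 3, 4 :: nat}" "{1, 2, 4, 5, 6} - {2, 5} = {1, 4, 6 :: nat}"
      by auto
    then show ?thesis unfolding 1 using nz by (simp add: hexagon_stress_def k5_stress_def)
  next
    case 2
    then show ?thesis by (simp add: hexagon_stress_def k5_stress_def)
  qed
qed

text \<open>
  Every edge other than \<open>14\<close> has an end of degree four, and the vertices of degree four are connected
  by edges of the graph, so the zero spreads from star to star. What remains is the edge \<open>14\<close>, which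
  is then alone at the vertex \<open>1\<close>.
\<close>

lemma hexagon_dependence_zero:
  assumes gp: "general_position 6 q" and dep: "cofactor_dependence 3 q hexagon_graph l"
    and e: "e \<in> hexagon_graph" "e \<noteq> {1, 4}" "l e = 0"
    and f: "f \<in> hexagon_graph"
  shows "l f = 0"
proof -
  note sub = hexagon_graph_subset
  have nbs: "{j. {2, j} \<in> hexagon_graph} = {1, 3, 4, 6}" "{j. {3, j} \<in> hexagon_graph} = {1, 2, 4, 5}"
    "{j. {5, j} \<in> hexagon_graph} = {1, 3, 4, 6}" "{j. {6, j} \<in> hexagon_graph} = {1, 2, 4, 5}"
    by (auto simp: doubleton_mem_hexagon_graph)
  have four: "card {j. {v, j} \<in> hexagon_graph} = 4" if "v \<in> {2, 3, 5, 6}" for v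
    using that nbs by auto
  have star: "l {v, b} = 0"
    if "v \<in> {2, 3, 5, 6}" "{v, a} \<in> hexagon_graph" "l {v, a} = 0" "{v, b} \<in> hexagon_graph" for v a b
    using four_valent_vertex_zero[OF gp sub dep four[OF that(1)] that(2-4)] .
  obtain v a where va: "v \<in> {2, 3, 5, 6}" "{v, a} \<in> hexagon_graph" "l {v, a} = 0"
  proof -
    obtain i j where ij: "e = {i, j}" "{i, j} \<in> hexagon_graph" "i < j"
      using hexagon_graph_cases[OF e(1)] .
    then have "i \<in> {2, 3, 5, 6} \<or> j \<in> {2, 3, 5, 6}"
      using e(2) unfolding doubleton_mem_hexagon_graph by auto
    moreover have "{j, i} = {i, j}" by auto
    ultimately show ?thesis using that[of i j] that[of j i] ij e(3) by auto
  qed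
  have cyc: "{2, 3} \<in> hexagon_graph" "{3, 5} \<in> hexagon_graph" "{5, 6} \<in> hexagon_graph"
      "{6, 2} \<in> hexagon_graph" "{3, 2} \<in> hexagon_graph" "{5, 3} \<in> hexagon_graph"
      "{6, 5} \<in> hexagon_graph" "{2, 6} \<in> hexagon_graph"
    by (simp_all add: doubleton_mem_hexagon_graph)
  \<comment> \<open>The four-valent vertices form the cycle 2, 3, 5, 6.\<close>
  have step: "\<forall>b. {w, b} \<in> hexagon_graph \<longrightarrow> l {w, b} = 0"
    if "\<forall>b. {u, b} \<in> hexagon_graph \<longrightarrow> l {u, b} = 0" "{u, w} \<in> hexagon_graph" "w \<in> {2, 3, 5, 6}" for u w
  proof -
    have "{w, u} = {u, w}" by auto
    then have "{w, u} \<in> hexagon_graph" "l {w, u} = 0" using that by auto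
    then show ?thesis using star[OF that(3)] by blast
  qed
  have "\<forall>b. {v, b} \<in> hexagon_graph \<longrightarrow> l {v, b} = 0" using star va by blast
  then have all: "\<forall>u\<in>{2, 3, 5, 6}. \<forall>b. {u, b} \<in> hexagon_graph \<longrightarrow> l {u, b} = 0"
    using va(1) step[of 2 3] step[of 3 5] step[of 5 6] step[of 6 2] cyc by auto
  have outside: "l {i, j} = 0" if "{i, j} \<in> hexagon_graph" "i < j" "(i, j) \<noteq> (1, 4)" for i j
  proof -
    have "i \<in> {2, 3, 5, 6} \<or> j \<in> {2, 3, 5, 6}"
      using that unfolding doubleton_mem_hexagon_graph by auto
    moreover have "{j, i} = {i, j}" by auto
    ultimately show ?thesis using all that(1) by metis
  qed
  have nb1: "{j. {1, j} \<in> hexagon_graph} = {2, 3, 4, 5, 6}"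
    by (auto simp: doubleton_mem_hexagon_graph)
  have w: "l {1, 2} = 0" "l {1, 3} = 0" "l {1, 5} = 0" "l {1, 6} = 0"
    by (auto intro!: outside simp: doubleton_mem_hexagon_graph)
  have "(\<Sum>j\<in>{2, 3, 4, 5, 6}. oriented l 1 j *
      (bracket (q 1) (q 2) (q j) * bracket (q 1) (q 2) (q j))) = 0"
    using balanced_quadratic[of q hexagon_graph l 1 "q 2" "q 2"] dep dependence_iff_balanced[OF sub]
    unfolding nb1 by blast
  then have "l {1, 4} * (bracket (q 1) (q 2) (q 4) * bracket (q 1) (q 2) (q 4)) = 0"
    using w by (simp add: oriented_def)
  moreover have "bracket (q 1) (q 2) (q 4) \<noteq> 0" using general_position_bracket[OF gp] by auto
  ultimately have l14: "l {1, 4} = 0" by simp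
  obtain i j where f_eq: "f = {i, j}" and ij: "{i, j} \<in> hexagon_graph" "i < j"
    using hexagon_graph_cases[OF f] .
  show ?thesis
  proof (cases "(i, j) = (1, 4)")
    case True
    then show ?thesis using l14 f_eq by simp
  next
    case False
    show ?thesis unfolding f_eq by (rule outside[OF ij False])
  qed
qed

lemma hexagon_stress_35:
  assumes gp: "general_position 6 q"
  shows "hexagon_stress q {3, 5} \<noteq> 0"
proof -
  have "k5_stress q {1, 2, 3, 4, 5} {3, 5} \<noteq> 0"
    by (rule k5_stress_nonzero[OF gp]) auto
  moreover have "k5_stress q {1, 2, 4, 5, 6} {3, 5} = 0" by (simp add: k5_stress_def)
  moreover have "bracket (q 2) (q 5) (q 3) \<noteq> 0" using general_position_bracket[OF gp] by auto
  ultimately show ?thesis by (simp add: hexagon_stress_def)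
qed

text \<open>Subtract the multiple that agrees with \<open>m\<close> at \<open>35\<close>; a dependence with a zero there is zero.\<close>

lemma hexagon_dependence_unique:
  assumes gp: "general_position 6 q" and dep: "cofactor_dependence 3 q hexagon_graph m"
  shows "\<exists>c. \<forall>e\<in>hexagon_graph. m e = c * hexagon_stress q e"
proof -
  define c where "c = m {3, 5} / hexagon_stress q {3, 5}"
  let ?z = "\<lambda>e. 1 * m e - c * hexagon_stress q e"
  have "?z e = 0" if "e \<in> hexagon_graph" for e
  proof (rule hexagon_dependence_zero[OF gp, of ?z "{3, 5}"])
    show "cofactor_dependence 3 q hexagon_graph ?z"
      by (intro dependence_linear dep hexagon_stress_dependence gp)
    show "?z {3, 5} = 0" using hexagon_stress_35[OF gp] by (simp add: c_def)
  qed (use that in \<open>auto simp: doubleton_mem_hexagon_graph doubleton_eq_iff\<close>)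
  then have "m e = c * hexagon_stress q e" if "e \<in> hexagon_graph" for e
    using that by (metis mult_1 right_minus_eq)
  then show ?thesis by blast
qed

lemma hexagon_stress_14:
  assumes gp: "general_position 6 q"
  shows "hexagon_stress q {1, 4} =
    (bracket (q 2) (q 5) (q 3) * bracket (q 1) (q 4) (q 6)
      - bracket (q 2) (q 5) (q 6) * bracket (q 1) (q 4) (q 3)) /
    (bracket (q 1) (q 4) (q 2) * bracket (q 1) (q 4) (q 3) *
     bracket (q 1) (q 4) (q 5) * bracket (q 1) (q 4) (q 6))"
proof -
  have nz: "bracket (q 1) (q 4) (q m) \<noteq> 0" if "m \<in> {2, 3, 5, 6}" for m
    using general_position_bracket[OF gp] that by auto
  have "{1, 2, 3, 4, 5} - {1, 4} = {2, 3, 5 :: nat}" "{1, 2, 4, 5, 6} - {1, 4} = {2, 5, 6 :: nat}"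
    by auto
  then have stress: "hexagon_stress q {1, 4} =
      bracket (q 2) (q 5) (q 3) / (bracket (q 1) (q 4) (q 2) * bracket (q 1) (q 4) (q 3) *
        bracket (q 1) (q 4) (q 5)) -
      bracket (q 2) (q 5) (q 6) / (bracket (q 1) (q 4) (q 2) * bracket (q 1) (q 4) (q 5) *
        bracket (q 1) (q 4) (q 6))"
    by (simp add: hexagon_stress_def k5_stress_def mult.assoc)
  show ?thesis
    unfolding stress using nz by (simp add: divide_simps)
qed

text \<open>The two terms combine by the Pluecker relation with base point \<open>5\<close>.\<close>

lemma hexagon_stress_15:
  assumes gp: "general_position 6 q"
  shows "hexagon_stress q {1, 5} =
    bracket (q 1) (q 2) (q 5) * bracket (q 3) (q 5) (q 6) /
    (bracket (q 1) (q 5) (q 2) * bracket (q 1) (q 5) (q 3) *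
     bracket (q 1) (q 5) (q 4) * bracket (q 1) (q 5) (q 6))"
proof -
  have nz: "bracket (q 1) (q 5) (q m) \<noteq> 0" if "m \<in> {2, 3, 4, 6}" for m
    using general_position_bracket[OF gp] that by auto
  have "bracket (q 2) (q 5) (q 3) * bracket (q 1) (q 5) (q 6)
      - bracket (q 2) (q 5) (q 6) * bracket (q 1) (q 5) (q 3)
      = bracket (q 1) (q 2) (q 5) * bracket (q 3) (q 5) (q 6)"
    by (simp add: bracket_def algebra_simps)
  note pluecker = this[symmetric]
  have "{1, 2, 3, 4, 5} - {1, 5} = {2, 3, 4 :: nat}" "{1, 2, 4, 5, 6} - {1, 5} = {2, 4, 6 :: nat}"
    by auto
  then have stress: "hexagon_stress q {1, 5} =
      bracket (q 2) (q 5) (q 3) / (bracket (q 1) (q 5) (q 2) * bracket (q 1) (q 5) (q 3) *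
        bracket (q 1) (q 5) (q 4)) -
      bracket (q 2) (q 5) (q 6) / (bracket (q 1) (q 5) (q 2) * bracket (q 1) (q 5) (q 4) *
        bracket (q 1) (q 5) (q 6))"
    by (simp add: hexagon_stress_def k5_stress_def mult.assoc)
  show ?thesis
    unfolding stress pluecker using nz by (simp add: divide_simps)
qed

text \<open>
  The numerator at \<open>14\<close> is a multiple of \<open>[25p]\<close> by \<open>bracket_at_intersection\<close>. All other brackets that
  occur have the common sign of the orientation after sorting their points.
\<close>

lemma hexagon_ratio_sign:
  assumes gp: "general_position 6 q" and conv: "convex_position 6 q"
    and p: "p \<in> line (q 1) (q 4)" "p \<in> line (q 3) (q 6)"
  obtains r where "r > 0"
    "hexagon_stress q {1, 4} / hexagon_stress q {1, 5}
      = - r * (bracket (q 2) (q 5) (q 1) * bracket (q 2) (q 5) p)"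
proof -
  obtain s :: real where s: "s = 1 \<or> s = - 1"
    and pos: "\<And>i j k. 1 \<le> i \<Longrightarrow> i < j \<Longrightarrow> j < k \<Longrightarrow> k \<le> 6 \<Longrightarrow> s * bracket (q i) (q j) (q k) > 0"
    using convex_position_orientation[OF gp conv] by metis
  let ?B = "\<lambda>i j k. bracket (q i) (q j) (q k)"
  define A where "A = (\<lambda>i j k. s * ?B i j k)"
  have ne: "q 1 \<noteq> q 4" "q 3 \<noteq> q 6"
    using general_position_bracket[OF gp, of 1 4 2] general_position_bracket[OF gp, of 3 6 2] by auto
  have num: "bracket (q 2) (q 5) p * (?B 1 4 6 + ?B 1 3 4) = ?B 2 5 3 * ?B 1 4 6 - ?B 2 5 6 * ?B 1 4 3"
    using bracket_at_intersection[OF ne p, of "q 2" "q 5"] bracket_swap_right[of "q 1" "q 4" "q 3"] by simp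
  \<comment> \<open>A homogeneous expression of even degree in the brackets, hence insensitive to the factor \<open>s\<close>.\<close>
  let ?r = "(A 1 4 6 + A 1 3 4) * A 1 3 5 * A 1 4 5 * A 1 5 6 /
    (A 1 2 5 * A 1 2 4 * A 1 3 4 * A 1 4 5 * A 1 4 6 * A 3 5 6)"
  have "A i j k > 0" if "1 \<le> i" "i < j" "j < k" "k \<le> 6" for i j k
    unfolding A_def using that by (rule pos)
  then have r: "?r > 0" by (intro divide_pos_pos mult_pos_pos add_pos_pos) simp_all
  have nz: "?B 1 2 5 \<noteq> 0" "?B 1 2 4 \<noteq> 0" "?B 1 3 4 \<noteq> 0" "?B 1 4 5 \<noteq> 0" "?B 1 4 6 \<noteq> 0"
      "?B 3 5 6 \<noteq> 0" "?B 1 3 5 \<noteq> 0" "?B 1 5 6 \<noteq> 0"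
    using general_position_bracket[OF gp] by auto
  have rB: "?r = (?B 1 4 6 + ?B 1 3 4) * ?B 1 3 5 * ?B 1 4 5 * ?B 1 5 6 /
    (?B 1 2 5 * ?B 1 2 4 * ?B 1 3 4 * ?B 1 4 5 * ?B 1 4 6 * ?B 3 5 6)"
    using s
  proof
    assume "s = 1"
    then show ?thesis by (simp add: A_def)
  next
    assume "s = - 1"
    then have "A i j k = - ?B i j k" for i j k by (simp add: A_def)
    then show ?thesis by (simp add: algebra_simps diff_divide_distrib add_divide_distrib)
  qed
  have l14: "hexagon_stress q {1, 4} = bracket (q 2) (q 5) p * (?B 1 4 6 + ?B 1 3 4) /
      (?B 1 2 4 * ?B 1 3 4 * ?B 1 4 5 * ?B 1 4 6)"
    unfolding hexagon_stress_14[OF gp] num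
      bracket_swap_right[of "q 1" "q 4" "q 2"] bracket_swap_right[of "q 1" "q 4" "q 3"] by simp
  have l15: "hexagon_stress q {1, 5} = - ?B 3 5 6 / (?B 1 3 5 * ?B 1 4 5 * ?B 1 5 6)"
    unfolding hexagon_stress_15[OF gp] bracket_swap_right[of "q 1" "q 5" "q 2"]
      bracket_swap_right[of "q 1" "q 5" "q 3"] bracket_swap_right[of "q 1" "q 5" "q 4"]
    using nz by simp
  have b: "bracket (q 2) (q 5) (q 1) = ?B 1 2 5" by (rule bracket_rotate)
  have "hexagon_stress q {1, 4} / hexagon_stress q {1, 5}
      = - ?r * (bracket (q 2) (q 5) (q 1) * bracket (q 2) (q 5) p)"
    unfolding rB l14 l15 b using nz by (simp add: divide_simps)
  then show ?thesis using that r by blast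
qed

theorem theorem3p7:
  fixes q :: "nat \<Rightarrow> real \<times> real" and G :: "nat set set"
  assumes G: "G = complete_graph 6 - {{2, 5}, {3, 6}}"
    and gp: "general_position 6 q"
  shows "cofactor_spanning 3 6 q G \<and>
     (\<exists>l. cofactor_dependence 3 q G l \<and> nontrivial_on G l \<and>
          (\<forall>m. cofactor_dependence 3 q G m \<longrightarrow> (\<exists>c. \<forall>e\<in>G. m e = c * l e))) \<and>
     (\<forall>l. cofactor_dependence 3 q G l \<and> nontrivial_on G l \<longrightarrow>
          (\<forall>e\<in>G - {{1, 4}}. l e \<noteq> 0)) \<and>
     (convex_position 6 q \<longrightarrow>
       (\<forall>l. cofactor_dependence 3 q G l \<and> nontrivial_on G l \<longrightarrow>
          l {1, 5} \<noteq> 0 \<and>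
          (positively_oriented q \<longrightarrow> l {1, 4} / l {1, 5} > 0) \<and>
          (negatively_oriented q \<longrightarrow> l {1, 4} / l {1, 5} < 0) \<and>
          (desargues_position q \<longrightarrow> l {1, 4} / l {1, 5} = 0)))"
proof -
  have G': "G = hexagon_graph" using G by (simp add: hexagon_graph_def)
  have mem: "{1, 4} \<in> G" "{1, 5} \<in> G" "{3, 5} \<in> G"
    by (simp_all add: G' doubleton_mem_hexagon_graph)
  have nonzero: "l e \<noteq> 0"
    if "cofactor_dependence 3 q G l" "nontrivial_on G l" "e \<in> G - {{1, 4}}" for l e
    using that hexagon_dependence_zero[OF gp, of l e] unfolding G' nontrivial_on_def by blast
  have unique: "\<exists>l. cofactor_dependence 3 q G l \<and> nontrivial_on G l \<and>
      (\<forall>m. cofactor_dependence 3 q G m \<longrightarrow> (\<exists>c. \<forall>e\<in>G. m e = c * l e))"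
    using hexagon_stress_dependence[OF gp] hexagon_stress_35[OF gp] hexagon_dependence_unique[OF gp] mem(3)
    unfolding nontrivial_on_def G' by blast
  have signs: "l {1, 5} \<noteq> 0 \<and> (positively_oriented q \<longrightarrow> l {1, 4} / l {1, 5} > 0) \<and>
      (negatively_oriented q \<longrightarrow> l {1, 4} / l {1, 5} < 0) \<and>
      (desargues_position q \<longrightarrow> l {1, 4} / l {1, 5} = 0)"
    if conv: "convex_position 6 q" and l: "cofactor_dependence 3 q G l" "nontrivial_on G l" for l
  proof -
    let ?P = "bracket (q 2) (q 5) (q 1)"
    have l15: "l {1, 5} \<noteq> 0" using nonzero[OF l] mem by (auto simp: doubleton_eq_iff)
    obtain c where "\<forall>e\<in>G. l e = c * hexagon_stress q e"
      using hexagon_dependence_unique[OF gp] l(1) unfolding G' by blast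
    then have ratio: "l {1, 4} / l {1, 5} = hexagon_stress q {1, 4} / hexagon_stress q {1, 5}"
      using mem l15 by auto
    have sign: "\<exists>r > 0. l {1, 4} / l {1, 5} = - r * (?P * bracket (q 2) (q 5) p)"
      if "p \<in> line (q 1) (q 4)" "p \<in> line (q 3) (q 6)" for p
      using hexagon_ratio_sign[OF gp conv that] unfolding ratio by metis
    have P: "?P \<noteq> 0" using general_position_bracket[OF gp] by auto
    then have q25: "q 2 \<noteq> q 5" by auto
    have upper: "x \<in> upper_side q \<longleftrightarrow> ?P * bracket (q 2) (q 5) x > 0" for x
      unfolding upper_side_def using mem_side_containing_iff[OF P] .
    have lower: "x \<in> lower_side q \<longleftrightarrow> ?P * bracket (q 2) (q 5) x < 0" for x
      unfolding lower_side_def using upper[of x] mem_line_iff[OF q25, of x] P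
      by (auto simp: not_less le_less)
    have "l {1, 4} / l {1, 5} > 0" if pos: "positively_oriented q"
    proof -
      obtain p where p: "p \<in> line (q 1) (q 4)" "p \<in> line (q 3) (q 6)" "p \<in> lower_side q"
        using pos unfolding positively_oriented_def by auto
      then obtain r where "r > 0" "l {1, 4} / l {1, 5} = - r * (?P * bracket (q 2) (q 5) p)"
        using sign by blast
      then show ?thesis using p(3) lower by (simp add: mult_pos_neg)
    qed
    moreover have "l {1, 4} / l {1, 5} < 0" if neg: "negatively_oriented q"
    proof -
      obtain p where p: "p \<in> line (q 1) (q 4)" "p \<in> line (q 3) (q 6)" "p \<in> upper_side q"
        using neg unfolding negatively_oriented_def by auto
      then obtain r where "r > 0" "l {1, 4} / l {1, 5} = - r * (?P * bracket (q 2) (q 5) p)"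
        using sign by blast
      then show ?thesis using p(3) upper by simp
    qed
    moreover have "l {1, 4} / l {1, 5} = 0" if des: "desargues_position q"
    proof -
      obtain p where p: "p \<in> line (q 1) (q 4)" "p \<in> line (q 3) (q 6)" "p \<in> line (q 2) (q 5)"
        using des unfolding desargues_position_def by auto
      then obtain r where "l {1, 4} / l {1, 5} = - r * (?P * bracket (q 2) (q 5) p)"
        using sign by blast
      then show ?thesis using p(3) mem_line_iff[OF q25, of p] by simp
    qed
    ultimately show ?thesis using l15 by blast
  qed
  show ?thesis
    using hexagon_spanning[OF gp] unique nonzero signs unfolding G' by blast
qed

end
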